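(* Let $n\ge 2$ and let $\Gamma=\mathcal{P}_e(SD_{8n})$ be the enhanced power graph of the semidihedral group $SD_{8n}$. The resolving polynomial of $\Gamma$ is \[\beta(\Gamma,x)=x^{8n}+8n\,x^{8n-1}+\sum_{i=7n-4}^{8n-2} r_i x^i,\] where \[r_i=\begin{cases}\displaystyle\sum_{j=0}^{i-(7n-4)}\binom{n}{j}2^{n-j}k_{7n+j-i}, & 7n-4\le i\le 7n-1,\\[2mm] \displaystyle\sum_{j=0}^{4}\binom{n}{i-7n+j}2^{n-(i-7n+j)}k_j, & 7n\le i\le 8n-4,\\[2mm] \displaystyle\sum_{j=0}^{8n-i}\binom{n}{n+j-(8n-i)}2^{n-(n+j-(8n-i))}k_j, & 8n-3\le i\le 8n-2,\end{cases}\] and $k_0=1$, $k_1=6n$, $k_2=8n^2+8n-3$, $k_3=16n^2-2n-2$, $k_4=8n^2-4n$.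
   Context: For $n\ge 2$, the semidihedral group of order $8n$ is $SD_{8n}=\langle a,b : a^{4n}=b^2=e,\ ba=a^{2n-1}b\rangle$. The enhanced power graph $\mathcal{P}_e(G)$ of a finite group $G$ is the simple undirected graph with vertex set $G$ in which two distinct vertices $x,y$ are adjacent if and only if $x,y\in\langle z\rangle$ for some $z\in G$. In a connected graph $\Gamma$ with shortest-path distance $d$, a vertex $z$ resolves vertices $u,v$ if $d(z,u)\ne d(z,v)$. A set $U\subseteq V(\Gamma)$ is a resolving set if every pair of distinct vertices of $\Gamma$ is resolved by some vertex of $U$. The metric dimension $\dim(\Gamma)$ is the least cardinality of a resolving set. If $\Gamma$ has order $N$ and $r_i$ is the number of resolving sets of cardinality $i$, the resolving polynomial is $\beta(\Gamma,x)=\sum_{i=\dim(\Gamma)}^{N} r_i x^i$. Convention: $\binom{n}{m}=0$ if $m<0$ or $m>n$. *)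

theory Defs
  imports
    "HOL-Algebra.Generated_Groups"
    "HOL-Computational_Algebra.Polynomial"
    "Graph_Theory.Pair_Digraph"
    "Graph_Theory.Shortest_Path"
begin

text \<open>
  A word is a list of signed generators: \<open>(g, True)\<close> stands for \<open>g\<close> and
  \<open>(g, False)\<close> for its formal inverse. A relation \<open>u = v\<close> is the pair \<open>(u, v)\<close>.
\<close>

type_synonym 'g word = "('g \<times> bool) list"

inductive_set word_cong :: "('g word \<times> 'g word) set \<Rightarrow> ('g word \<times> 'g word) set"
  for R :: "('g word \<times> 'g word) set" where
  rel: "(u, v) \<in> R \<Longrightarrow> (u, v) \<in> word_cong R"
| cancel: "([(g, s), (g, \<not> s)], []) \<in> word_cong R"
| refl: "(u, u) \<in> word_cong R"
| sym: "(u, v) \<in> word_cong R \<Longrightarrow> (v, u) \<in> word_cong R"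
| trans: "(u, v) \<in> word_cong R \<Longrightarrow> (v, w) \<in> word_cong R \<Longrightarrow> (u, w) \<in> word_cong R"
| mult: "(u, u') \<in> word_cong R \<Longrightarrow> (v, v') \<in> word_cong R \<Longrightarrow> (u @ v, u' @ v') \<in> word_cong R"

definition presented_group :: "('g word \<times> 'g word) set \<Rightarrow> 'g word set monoid" where
  "presented_group R = \<lparr>
     carrier = UNIV // word_cong R,
     monoid.mult = (\<lambda>X Y. \<Union>u\<in>X. \<Union>v\<in>Y. word_cong R `` {u @ v}),
     one = word_cong R `` {[]}\<rparr>"

lemma equiv_word_cong: "equiv UNIV (word_cong R)"
  by (rule equivI) (auto simp: refl_on_def intro!: symI transI intro: word_cong.intros)

lemma presented_group_mult:
  "word_cong R `` {u} \<otimes>\<^bsub>presented_group R\<^esub> word_cong R `` {v} = word_cong R `` {u @ v}"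
proof -
  have "congruent2 (word_cong R) (word_cong R) (\<lambda>u v. word_cong R `` {u @ v})"
    by (auto simp: congruent2_def
        intro!: equiv_class_eq[OF equiv_word_cong] word_cong.mult)
  then show ?thesis
    by (simp add: presented_group_def UN_equiv_class2[OF equiv_word_cong equiv_word_cong])
qed

lemma group_presented_group: "group (presented_group R)"
proof (rule groupI)
  let ?G = "presented_group R"
  have cls: "\<exists>u. X = word_cong R `` {u}" if "X \<in> carrier ?G" for X
    using that by (auto simp: presented_group_def elim: quotientE)
  have in_carrier: "word_cong R `` {u} \<in> carrier ?G" for u
    by (simp add: presented_group_def quotientI)
  have one: "\<one>\<^bsub>?G\<^esub> = word_cong R `` {[]}"
    by (simp add: presented_group_def)
  show "\<one>\<^bsub>?G\<^esub> \<in> carrier ?G"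
    by (simp add: one in_carrier)
  show "X \<otimes>\<^bsub>?G\<^esub> Y \<in> carrier ?G" if "X \<in> carrier ?G" "Y \<in> carrier ?G" for X Y
    using cls[OF that(1)] cls[OF that(2)] by (auto simp: presented_group_mult in_carrier)
  show "X \<otimes>\<^bsub>?G\<^esub> Y \<otimes>\<^bsub>?G\<^esub> Z = X \<otimes>\<^bsub>?G\<^esub> (Y \<otimes>\<^bsub>?G\<^esub> Z)"
    if "X \<in> carrier ?G" "Y \<in> carrier ?G" "Z \<in> carrier ?G" for X Y Z
    using cls[OF that(1)] cls[OF that(2)] cls[OF that(3)] by (auto simp: presented_group_mult)
  show "\<one>\<^bsub>?G\<^esub> \<otimes>\<^bsub>?G\<^esub> X = X" if "X \<in> carrier ?G" for X
    using cls[OF that] by (auto simp: one presented_group_mult)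
  have inverse: "\<exists>v. (v @ u, []) \<in> word_cong R" for u
  proof (induction u)
    case Nil
    show ?case using word_cong.refl[of "[]" R] by auto
  next
    case (Cons x u)
    obtain g s where x: "x = (g, s)" by (cases x)
    obtain v where v: "(v @ u, []) \<in> word_cong R" using Cons by blast
    have "([(g, \<not> s), (g, s)], []) \<in> word_cong R"
      using word_cong.cancel[of g "\<not> s" R] by simp
    from word_cong.mult[OF word_cong.refl[of v] word_cong.mult[OF this word_cong.refl[of u]]]
    have "((v @ [(g, \<not> s)]) @ x # u, v @ u) \<in> word_cong R"
      by (simp add: x)
    with v show ?case by (blast intro: word_cong.trans)
  qed
  show "\<exists>Y\<in>carrier ?G. Y \<otimes>\<^bsub>?G\<^esub> X = \<one>\<^bsub>?G\<^esub>" if X: "X \<in> carrier ?G" for X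
  proof -
    obtain u where u: "X = word_cong R `` {u}" using cls[OF X] by blast
    obtain v where "(v @ u, []) \<in> word_cong R" using inverse by blast
    then have "word_cong R `` {v} \<otimes>\<^bsub>?G\<^esub> X = \<one>\<^bsub>?G\<^esub>"
      by (simp add: u one presented_group_mult equiv_class_eq[OF equiv_word_cong])
    then show ?thesis using in_carrier by blast
  qed
qed

datatype sd_gen = Gen_a | Gen_b

abbreviation word_a :: "sd_gen word" where "word_a \<equiv> [(Gen_a, True)]"
abbreviation word_b :: "sd_gen word" where "word_b \<equiv> [(Gen_b, True)]"

definition word_pow :: "'g word \<Rightarrow> nat \<Rightarrow> 'g word" where
  "word_pow w m = concat (replicate m w)"

text \<open>\<open>SD n\<close> is the semidihedral group of order \<open>8 n\<close>, so the index is not the order.\<close>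

definition SD :: "nat \<Rightarrow> sd_gen word set monoid" where
  "SD n = presented_group
     {(word_pow word_a (4 * n), []),
      (word_pow word_b 2, []),
      (word_b @ word_a, word_pow word_a (2 * n - 1) @ word_b)}"

text \<open>
  A simple undirected graph is a \<^locale>\<open>pair_graph\<close>: each edge is present as a pair of
  opposite arcs.
\<close>

definition enhanced_power_graph :: "('a, 'b) monoid_scheme \<Rightarrow> 'a pair_pre_digraph" where
  "enhanced_power_graph G = \<lparr>
     pverts = carrier G,
     parcs = {(x, y). x \<in> carrier G \<and> y \<in> carrier G \<and> x \<noteq> y \<and>
       (\<exists>z\<in>carrier G. x \<in> generate G {z} \<and> y \<in> generate G {z})}\<rparr>"

lemma pair_graph_enhanced_power_graph:
  assumes "finite (carrier G)"
  shows "pair_graph (enhanced_power_graph G)"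
proof
  show "finite (parcs (enhanced_power_graph G))"
    by (rule finite_subset[of _ "carrier G \<times> carrier G"])
      (auto simp: enhanced_power_graph_def assms)
  show "symmetric (enhanced_power_graph G)"
    by (auto simp: symmetric_def enhanced_power_graph_def intro!: symI)
qed (auto simp: enhanced_power_graph_def assms)

definition graph_dist :: "'a pair_pre_digraph \<Rightarrow> 'a \<Rightarrow> 'a \<Rightarrow> ereal" where
  "graph_dist \<Gamma> u v = wf_digraph.\<mu> (with_proj \<Gamma>) (\<lambda>_. 1) u v"

definition resolves :: "'a pair_pre_digraph \<Rightarrow> 'a \<Rightarrow> 'a \<Rightarrow> 'a \<Rightarrow> bool" where
  "resolves \<Gamma> z u v \<longleftrightarrow> graph_dist \<Gamma> z u \<noteq> graph_dist \<Gamma> z v"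

definition resolving_set :: "'a pair_pre_digraph \<Rightarrow> 'a set \<Rightarrow> bool" where
  "resolving_set \<Gamma> U \<longleftrightarrow> U \<subseteq> pverts \<Gamma> \<and>
     (\<forall>u\<in>pverts \<Gamma>. \<forall>v\<in>pverts \<Gamma>. u \<noteq> v \<longrightarrow> (\<exists>z\<in>U. resolves \<Gamma> z u v))"

definition metric_dim :: "'a pair_pre_digraph \<Rightarrow> nat" where
  "metric_dim \<Gamma> = (LEAST m. \<exists>U. resolving_set \<Gamma> U \<and> card U = m)"

definition resolving_poly :: "'a pair_pre_digraph \<Rightarrow> int poly" where
  "resolving_poly \<Gamma> =
     (\<Sum>i = metric_dim \<Gamma>..card (pverts \<Gamma>).
        monom (int (card {U. resolving_set \<Gamma> U \<and> card U = i})) i)"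

text \<open>
  Integer arguments, because the convention that the binomial coefficient is \<open>0\<close> also for
  \<open>m < 0\<close> would be lost under truncated subtraction.
\<close>

definition binom :: "nat \<Rightarrow> int \<Rightarrow> int" where
  "binom n m = (if m < 0 then 0 else int (n choose nat m))"

text \<open>
  The product \<open>binom n m * 2 ^ (n - m)\<close>; truncating the exponent is harmless, because the
  binomial coefficient vanishes for \<open>m > n\<close>.
\<close>

definition binom_pow2 :: "nat \<Rightarrow> int \<Rightarrow> int" where
  "binom_pow2 n m = binom n m * 2 ^ nat (int n - m)"

text \<open>Only \<open>k\<^sub>0, \<dots>, k\<^sub>4\<close> are specified and used; the last line is a default value.\<close>

definition k_coeff :: "nat \<Rightarrow> nat \<Rightarrow> int" where
  "k_coeff n j =
     (if j = 0 then 1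
      else if j = 1 then 6 * int n
      else if j = 2 then 8 * (int n)\<^sup>2 + 8 * int n - 3
      else if j = 3 then 16 * (int n)\<^sup>2 - 2 * int n - 2
      else if j = 4 then 8 * (int n)\<^sup>2 - 4 * int n
      else 0)"

end

theory Submission
  imports Defs
begin

text \<open>
  Since \<open>(a\<^sup>i b)\<^sup>2 = a\<^bsup>2ni\<^esup>\<close>, the element \<open>a\<^sup>i b\<close> is an involution for even \<open>i\<close>, and for odd \<open>i\<close>
  it has order four and square \<open>a\<^bsup>2n\<^esup>\<close>. Hence every cyclic subgroup lies in \<open>\<langle>a\<rangle>\<close>, in one of the
  \<open>n\<close> groups \<open>{e, a\<^bsup>2n\<^esup>, a\<^sup>i b, a\<^bsup>i+2n\<^esup> b}\<close> with \<open>i\<close> odd, or in one of the \<open>2n\<close> groups \<open>{e, a\<^sup>i b}\<close>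
  with \<open>i\<close> even. Whether two distinct vertices of the enhanced power graph are adjacent therefore
  depends only on their classes in the partition into \<open>{e}\<close>, \<open>{a\<^bsup>2n\<^esup>}\<close>, the other \<open>4n - 2\<close>
  powers of \<open>a\<close>, the \<open>2n\<close> involutions \<open>a\<^sup>i b\<close>, and the \<open>n\<close> pairs \<open>{a\<^sup>i b, a\<^bsup>i+2n\<^esup> b}\<close> with
  \<open>i\<close> odd (\<open>parcs_sd_graph_iff\<close>).

  The identity is adjacent to every other vertex, so a distance is \<open>0\<close>, \<open>1\<close> or \<open>2\<close> according to
  equality, adjacency or neither. Two vertices of one class have the same distance to
  every third vertex, so only these two resolve them: a resolving set misses at most one vertex of
  each class. This is also sufficient. If two vertices of different classes are both missing, then
  some class of size at least two is adjacent to one of their classes and not to the other,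
  and a member of that class belongs to the set (\<open>resolving_set_iff_inj_on\<close>,
  \<open>twin_classes_separated\<close>). So the resolving sets are the complements of the partial transversals
  of the partition, and the number of those with \<open>8n - m\<close> elements is the coefficient of \<open>x\<^sup>m\<close> in
  \<open>(1 + x)\<^sup>2 (1 + (4n - 2) x) (1 + 2n x) (1 + 2x)\<^sup>n\<close> (\<open>card_partial_transversals\<close>,
  \<open>card_resolving_sets\<close>).
  The product of the factors before the last is \<open>k\<^sub>0 + k\<^sub>1 x + \<dots> + k\<^sub>4 x\<^sup>4\<close>, and the three cases of
  the formula for \<open>r\<^sub>i\<close> are this one convolution with different vanishing terms left out.

  Computations in the group need a normal form for its elements. The pairs \<open>(i, s)\<close> with
  \<open>i < 4n\<close>, read as \<open>a\<^sup>i b\<^sup>s\<close>, form a group that satisfies the defining relations. The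
  homomorphism that the presentation yields onto it has \<open>(i, s) \<mapsto> a\<^sup>i b\<^sup>s\<close> as inverse
  (\<open>sd_coord_iso\<close>).
\<close>

section \<open>Partial transversals of a partition\<close>

text \<open>
  A set on which \<open>t\<close> is injective picks from each fibre of \<open>t\<close> nothing (contributing \<open>1\<close>) or one of
  its elements (contributing \<open>x\<close> each), independently for different fibres. The
  induction adds one fibre at a time.
\<close>

lemma sum_partial_transversals:
  fixes t :: "'a \<Rightarrow> 'b"
  assumes "finite V"
  shows "(\<Sum>M | M \<subseteq> V \<and> inj_on t M. monom (1::int) (card M)) =
    (\<Prod>l\<in>t ` V. [:1, int (card {x \<in> V. t x = l}):])"
proof -
  define S where "S L = {M. M \<subseteq> {x \<in> V. t x \<in> L} \<and> inj_on t M}" for L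
  have S: "(\<Sum>M\<in>S L. monom (1::int) (card M)) = (\<Prod>l\<in>L. [:1, int (card {x \<in> V. t x = l}):])"
    if "finite L" for L
    using that
  proof (induction L rule: finite_induct)
    case empty
    have "S {} = {{}}" by (auto simp: S_def)
    then show ?case by (simp add: monom_0 one_pCons)
  next
    case (insert l L)
    define F where "F = {x \<in> V. t x = l}"
    have fin: "finite (S L)" "finite F"
      using assms by (auto simp: S_def F_def intro: rev_finite_subset[of "Pow V"])
    have fM: "finite M" "M \<subseteq> V" "x \<notin> M" if "M \<in> S L" "x \<in> F" for M x
      using that insert.hyps assms by (auto simp: S_def F_def intro: finite_subset[of _ V])
    \<comment> \<open>Either nothing of the fibre over \<open>l\<close> is picked, or exactly one element \<open>x\<close> of it.\<close>
    have split: "S (insert l L) = S L \<union> (\<lambda>(x, M). insert x M) ` (F \<times> S L)" (is "?A = ?B")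
    proof
      show "?A \<subseteq> ?B"
      proof
        fix M assume M: "M \<in> ?A"
        show "M \<in> ?B"
        proof (cases "\<exists>x\<in>M. t x = l")
          case False
          then have "M \<in> S L" using M by (auto simp: S_def)
          then show ?thesis by simp
        next
          case True
          then obtain x where x: "x \<in> M" "t x = l" by blast
          have "t y \<noteq> l" if "y \<in> M - {x}" for y
            using that x M by (auto simp: S_def dest: inj_onD)
          then have "M - {x} \<in> S L" "x \<in> F"
            using M x by (auto simp: S_def F_def intro: inj_on_subset)
          moreover have "M = (\<lambda>(x, M). insert x M) (x, M - {x})" using x by auto
          ultimately show ?thesis by blast
        qed
      qed
      show "?B \<subseteq> ?A"
        using insert.hyps by (auto simp: S_def F_def inj_on_insert)
    qed
    have disj: "S L \<inter> (\<lambda>(x, M). insert x M) ` (F \<times> S L) = {}"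
      using insert.hyps by (auto simp: S_def F_def)
    have inj: "inj_on (\<lambda>(x, M). insert x M) (F \<times> S L)"
    proof (rule inj_onI, clarify)
      fix x M y N
      assume *: "x \<in> F" "M \<in> S L" "y \<in> F" "N \<in> S L" "insert x M = insert y N"
      have "x \<notin> N" "y \<notin> M" "x \<notin> M" "y \<notin> N" using fM * by blast+
      with *(5) show "x = y \<and> M = N" by (metis insertCI insertE insert_ident)
    qed
    have "(\<Sum>M\<in>S (insert l L). monom (1::int) (card M)) = (\<Sum>M\<in>S L. monom 1 (card M)) +
        (\<Sum>p\<in>F \<times> S L. monom 1 (card ((\<lambda>(x, M). insert x M) p)))"
      unfolding split by (subst sum.union_disjoint[OF _ _ disj])
        (use fin inj in \<open>auto simp: sum.reindex\<close>)
    also have "(\<Sum>p\<in>F \<times> S L. monom (1::int) (card ((\<lambda>(x, M). insert x M) p))) =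
        (\<Sum>p\<in>F \<times> S L. monom 1 1 * monom 1 (card (snd p)))"
      by (rule sum.cong) (use fM in \<open>auto simp: mult_monom\<close>)
    also have "\<dots> = (\<Sum>x\<in>F. \<Sum>M\<in>S L. monom 1 1 * monom 1 (card M))"
      unfolding sum.cartesian_product by (rule sum.cong) auto
    also have "\<dots> = of_nat (card F) * (monom 1 1 * (\<Sum>M\<in>S L. monom 1 (card M)))"
      by (simp add: sum_distrib_left)
    also have "\<dots> = [:0, int (card F):] * (\<Sum>M\<in>S L. monom 1 (card M))"
      by (simp add: monom_Suc monom_0 of_nat_poly)
    finally have "(\<Sum>M\<in>S (insert l L). monom (1::int) (card M)) =
        [:1, int (card F):] * (\<Sum>M\<in>S L. monom 1 (card M))"
      by (simp add: algebra_simps)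
    then show ?case using insert by (simp add: F_def)
  qed
  have "S (t ` V) = {M. M \<subseteq> V \<and> inj_on t M}" by (auto simp: S_def)
  with S[of "t ` V"] assms show ?thesis by simp
qed

lemma card_partial_transversals:
  fixes t :: "'a \<Rightarrow> 'b"
  assumes "finite V"
  shows "int (card {M. M \<subseteq> V \<and> inj_on t M \<and> card M = m}) =
    coeff (\<Prod>l\<in>t ` V. [:1, int (card {x \<in> V. t x = l}):]) m"
proof -
  let ?T = "{M. M \<subseteq> V \<and> inj_on t M}"
  have "finite ?T" using assms by (auto intro: rev_finite_subset[of "Pow V"])
  then have "(\<Sum>M\<in>?T. if card M = m then 1 else 0 :: int) = int (card (?T \<inter> {M. card M = m}))"
    by (simp add: sum.If_cases)
  also have "?T \<inter> {M. card M = m} = {M. M \<subseteq> V \<and> inj_on t M \<and> card M = m}" by auto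
  finally show ?thesis
    by (simp add: sum_partial_transversals[OF assms, symmetric] coeff_sum coeff_monom)
qed

section \<open>Distances and twins in graphs with a dominating vertex\<close>

text \<open>
  Any two vertices are joined by a walk of length two through \<open>e\<close>.
\<close>

lemma graph_dist_hub:
  assumes "pair_graph \<Gamma>" and e: "e \<in> pverts \<Gamma>"
    and hub: "\<And>v. v \<in> pverts \<Gamma> \<Longrightarrow> v \<noteq> e \<Longrightarrow> (e, v) \<in> parcs \<Gamma>"
    and u: "u \<in> pverts \<Gamma>" and v: "v \<in> pverts \<Gamma>"
  shows "graph_dist \<Gamma> u v = (if u = v then 0 else if (u, v) \<in> parcs \<Gamma> then 1 else 2)"
proof -
  interpret pair_graph \<Gamma> by fact
  have cost: "awalk_cost (\<lambda>_. 1) p = length p" for p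
    by (induction p) auto
  have \<mu>: "graph_dist \<Gamma> u v = (INF p\<in>{p. awalk u p v}. ereal (length p))"
    by (simp add: graph_dist_def \<mu>_def cost)
  have eqI: "graph_dist \<Gamma> u v = ereal (length p)"
    if "awalk u p v" "\<And>q. awalk u q v \<Longrightarrow> length p \<le> length q" for p
    unfolding \<mu> using that by (intro INF_eqI) auto
  show ?thesis
  proof (cases "u = v")
    case True
    have "awalk u [] v" using True u by (simp add: awalk_def)
    from eqI[OF this] show ?thesis using True by (simp add: zero_ereal_def)
  next
    case ne: False
    show ?thesis
    proof (cases "(u, v) \<in> parcs \<Gamma>")
      case True
      have "awalk u [(u, v)] v" using True u by (simp add: awalk_def)
      moreover have "length [(u, v)] \<le> length q" if "awalk u q v" for q
        using that ne by (cases q) (auto simp: awalk_def)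
      ultimately show ?thesis using eqI[of "[(u, v)]"] ne True by (simp add: one_ereal_def)
    next
      case False
      have neq: "u \<noteq> e" "v \<noteq> e"
        using False hub u v ne arcs_symmetric by blast+
      have "awalk u [(u, e), (e, v)] v"
        using hub[OF u neq(1)] hub[OF v neq(2)] u by (auto simp: awalk_def arcs_symmetric)
      moreover have "length [(u, e), (e, v)] \<le> length q" if "awalk u q v" for q
        using that ne False by (cases q; cases "tl q") (auto simp: awalk_def)
      ultimately show ?thesis using eqI[of "[(u, e), (e, v)]"] ne False by simp
    qed
  qed
qed

text \<open>
  The labels \<open>t\<close> decide adjacency, so equally labelled vertices are twins. The hypothesis \<open>sep\<close>
  asks for a label that two vertices carry and that is adjacent to only one of \<open>t u\<close> and \<open>t v\<close>: a
  set that omits at most one vertex per label contains one of the two, which resolves \<open>u\<close> and \<open>v\<close>.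
\<close>

lemma resolving_set_iff_inj_on:
  assumes graph: "pair_graph \<Gamma>"
    and adj: "\<And>u v. u \<in> pverts \<Gamma> \<Longrightarrow> v \<in> pverts \<Gamma> \<Longrightarrow>
      (u, v) \<in> parcs \<Gamma> \<longleftrightarrow> u \<noteq> v \<and> R (t u) (t v)"
    and e: "e \<in> pverts \<Gamma>" and hub: "\<And>v. v \<in> pverts \<Gamma> \<Longrightarrow> R (t e) (t v)"
    and sep: "\<And>u v. u \<in> pverts \<Gamma> \<Longrightarrow> v \<in> pverts \<Gamma> \<Longrightarrow> t u \<noteq> t v \<Longrightarrow>
      \<exists>x\<in>pverts \<Gamma>. \<exists>y\<in>pverts \<Gamma>. x \<noteq> y \<and> t x = t y \<and> R (t x) (t u) \<noteq> R (t x) (t v)"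
  shows "resolving_set \<Gamma> U \<longleftrightarrow> U \<subseteq> pverts \<Gamma> \<and> inj_on t (pverts \<Gamma> - U)"
proof -
  let ?V = "pverts \<Gamma>"
  have dist: "graph_dist \<Gamma> u v = (if u = v then 0 else if R (t u) (t v) then 1 else 2)"
    if "u \<in> ?V" "v \<in> ?V" for u v
    using graph_dist_hub[OF graph e _ that] adj hub e that by simp
  have "\<exists>z\<in>U. resolves \<Gamma> z u v"
    if U: "U \<subseteq> ?V" "inj_on t (?V - U)" and uv: "u \<in> ?V" "v \<in> ?V" "u \<noteq> v" for u v
  proof -
    \<comment> \<open>A vertex of the set is resolved from all others by itself, so only pairs of missing vertices matter.\<close>
    consider "u \<in> U" | "v \<in> U" | "u \<notin> U" "v \<notin> U" by blast
    then show ?thesis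
    proof cases
      case 1
      then show ?thesis using uv by (intro bexI[of _ u]) (auto simp: resolves_def dist)
    next
      case 2
      then show ?thesis using uv by (intro bexI[of _ v]) (auto simp: resolves_def dist)
    next
      case 3
      then have "t u \<noteq> t v" using U uv by (auto dest: inj_onD)
      then obtain x y where xy: "x \<in> ?V" "y \<in> ?V" "x \<noteq> y" "t x = t y"
          "R (t x) (t u) \<noteq> R (t x) (t v)"
        using sep uv by blast
      then have "x \<in> U \<or> y \<in> U" using U by (auto dest: inj_onD)
      then obtain w where "w \<in> U" "t w = t x" using xy by metis
      then show ?thesis using 3 U uv xy
        by (intro bexI[of _ w]) (auto simp: resolves_def dist subset_iff)
    qed
  qed
  moreover have "inj_on t (?V - U)"
    if U: "U \<subseteq> ?V" "\<forall>u\<in>?V. \<forall>v\<in>?V. u \<noteq> v \<longrightarrow> (\<exists>z\<in>U. resolves \<Gamma> z u v)"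
  proof (rule inj_onI, rule ccontr)
    fix u v assume uv: "u \<in> ?V - U" "v \<in> ?V - U" "t u = t v" "u \<noteq> v"
    then obtain z where z: "z \<in> U" "resolves \<Gamma> z u v" using U by blast
    then have "z \<noteq> u" "z \<noteq> v" "z \<in> ?V" using U uv by auto
    then show False using z uv by (simp add: resolves_def dist)
  qed
  ultimately show ?thesis unfolding resolving_set_def by blast
qed

section \<open>Homomorphisms from presented groups\<close>

definition word_eval :: "('a, 'b) monoid_scheme \<Rightarrow> ('g \<Rightarrow> 'a) \<Rightarrow> 'g word \<Rightarrow> 'a" where
  "word_eval H f w = foldr (\<lambda>(g, s) x. (if s then f g else inv\<^bsub>H\<^esub> f g) \<otimes>\<^bsub>H\<^esub> x) w \<one>\<^bsub>H\<^esub>"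

lemma word_eval_Nil [simp]: "word_eval H f [] = \<one>\<^bsub>H\<^esub>"
  by (simp add: word_eval_def)

lemma word_eval_Cons [simp]:
  "word_eval H f ((g, s) # w) = (if s then f g else inv\<^bsub>H\<^esub> f g) \<otimes>\<^bsub>H\<^esub> word_eval H f w"
  by (simp add: word_eval_def)

context group
begin

lemma word_eval_closed [simp]:
  assumes "range f \<subseteq> carrier G"
  shows "word_eval G f w \<in> carrier G"
proof (induction w)
  case (Cons x w)
  then show ?case using assms by (cases x) (auto simp: image_subset_iff)
qed simp

lemma word_eval_append:
  assumes "range f \<subseteq> carrier G"
  shows "word_eval G f (u @ v) = word_eval G f u \<otimes> word_eval G f v"
proof (induction u)
  case Nil
  then show ?case using assms by simp
next
  case (Cons x u)
  have "f g \<in> carrier G" for g using assms by auto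
  then show ?case using Cons assms by (cases x) (auto simp: m_assoc)
qed

lemma word_eval_pow:
  assumes "range f \<subseteq> carrier G"
  shows "word_eval G f (word_pow w m) = word_eval G f w [^] m"
proof (induction m)
  case (Suc m)
  have "word_pow w (Suc m) = w @ word_pow w m" by (simp add: word_pow_def)
  then show ?case
    using Suc assms nat_pow_Suc2[of "word_eval G f w" m] by (simp add: word_eval_append)
qed (simp add: word_pow_def)

lemma word_eval_cong:
  assumes f: "range f \<subseteq> carrier G"
    and R: "\<And>u v. (u, v) \<in> R \<Longrightarrow> word_eval G f u = word_eval G f v"
    and "(u, v) \<in> word_cong R"
  shows "word_eval G f u = word_eval G f v"
  using assms(3)
proof induction
  case (cancel g s)
  have "f g \<in> carrier G" using f by auto
  then show ?case by simp
qed (use f R in \<open>simp_all add: word_eval_append\<close>)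

end

lemma (in group_hom) hom_word_eval:
  assumes "range f \<subseteq> carrier G"
  shows "h (word_eval G f w) = word_eval H (h \<circ> f) w"
proof (induction w)
  case (Cons x w)
  have "f g \<in> carrier G" for g using assms by auto
  then show ?case using Cons assms by (cases x) simp
qed simp

definition word_class :: "('g word \<times> 'g word) set \<Rightarrow> 'g word \<Rightarrow> 'g word set" where
  "word_class R w = word_cong R `` {w}"

lemma carrier_presented_group: "carrier (presented_group R) = range (word_class R)"
  by (auto simp: presented_group_def word_class_def quotient_def)

lemma word_class_eq_iff: "word_class R u = word_class R v \<longleftrightarrow> (u, v) \<in> word_cong R"
  unfolding word_class_def using eq_equiv_class_iff[OF equiv_word_cong] by auto

text \<open>
  In a presented group, a word evaluated at the classes of the generators is its own class. Together
  with \<open>hom_word_eval\<close> this says that homomorphisms on a presented group are determined by the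
  generators.
\<close>

lemma word_eval_presented_group:
  "word_eval (presented_group R) (\<lambda>g. word_class R [(g, True)]) w = word_class R w"
proof -
  let ?P = "presented_group R"
  interpret group ?P by (rule group_presented_group)
  have one: "\<one>\<^bsub>?P\<^esub> = word_class R []"
    by (simp add: presented_group_def word_class_def)
  have mult: "word_class R u \<otimes>\<^bsub>?P\<^esub> word_class R v = word_class R (u @ v)" for u v
    by (simp add: word_class_def presented_group_mult)
  have inv: "inv\<^bsub>?P\<^esub> word_class R [(g, True)] = word_class R [(g, False)]" for g
    using word_cong.cancel[of g False R]
    by (intro inv_equality) (auto simp: mult one carrier_presented_group word_class_eq_iff)
  show ?thesis
  proof (induction w)
    case (Cons x w)
    then show ?case by (cases x) (auto simp: inv mult)
  qed (simp add: one)
qed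

text \<open>
  By \<open>word_eval_cong\<close>, evaluation is constant on each class when \<open>H\<close> satisfies the relations; the
  unique value on a class is the image of the homomorphism induced by \<open>f\<close>.
\<close>

definition presented_lift ::
    "('a, 'b) monoid_scheme \<Rightarrow> ('g \<Rightarrow> 'a) \<Rightarrow> 'g word set \<Rightarrow> 'a" where
  "presented_lift H f X = the_elem (word_eval H f ` X)"

lemma presented_lift_word_class:
  assumes "group H" "range f \<subseteq> carrier H"
    and "\<And>u v. (u, v) \<in> R \<Longrightarrow> word_eval H f u = word_eval H f v"
  shows "presented_lift H f (word_class R w) = word_eval H f w"
proof -
  have "word_eval H f v = word_eval H f w" if "v \<in> word_class R w" for v
    using group.word_eval_cong[OF assms(1,2,3), of R w v] that by (simp add: word_class_def)
  moreover have "w \<in> word_class R w"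
    by (simp add: word_class_def word_cong.refl)
  ultimately have "word_eval H f ` word_class R w = {word_eval H f w}" by blast
  then show ?thesis by (simp add: presented_lift_def)
qed

lemma presented_lift_hom:
  assumes "group H" "range f \<subseteq> carrier H"
    and "\<And>u v. (u, v) \<in> R \<Longrightarrow> word_eval H f u = word_eval H f v"
  shows "presented_lift H f \<in> hom (presented_group R) H"
proof (rule homI)
  interpret group H by fact
  fix X Y assume "X \<in> carrier (presented_group R)" "Y \<in> carrier (presented_group R)"
  then obtain u v where XY: "X = word_class R u" "Y = word_class R v"
    by (auto simp: carrier_presented_group)
  show "presented_lift H f X \<in> carrier H"
    using assms by (simp add: XY presented_lift_word_class)
  have "X \<otimes>\<^bsub>presented_group R\<^esub> Y = word_class R (u @ v)"
    by (simp add: XY word_class_def presented_group_mult)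
  then show "presented_lift H f (X \<otimes>\<^bsub>presented_group R\<^esub> Y) =
      presented_lift H f X \<otimes>\<^bsub>H\<^esub> presented_lift H f Y"
    using assms by (simp add: XY presented_lift_word_class word_eval_append)
qed

section \<open>Normal form in the semidihedral group\<close>

text \<open>
  The pair \<open>(i, s)\<close> stands for \<open>a\<^sup>i\<close> or \<open>a\<^sup>i b\<close>; moving \<open>b\<close> past \<open>a\<^sup>j\<close> turns it into
  \<open>a\<^bsup>(2n-1)j\<^esup>\<close>.
\<close>

definition sd_model :: "nat \<Rightarrow> (nat \<times> bool) monoid" where
  "sd_model n = \<lparr>
     carrier = {..<4 * n} \<times> UNIV,
     monoid.mult = (\<lambda>(i, s) (j, t). ((i + (if s then (2 * n - 1) * j else j)) mod (4 * n), s \<noteq> t)),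
     one = (0, False)\<rparr>"

lemma carrier_sd_model: "carrier (sd_model n) = {..<4 * n} \<times> UNIV"
  and one_sd_model: "\<one>\<^bsub>sd_model n\<^esub> = (0, False)"
  and mult_sd_model: "(i, s) \<otimes>\<^bsub>sd_model n\<^esub> (j, t) =
    ((i + (if s then (2 * n - 1) * j else j)) mod (4 * n), s \<noteq> t)"
  unfolding sd_model_def by simp_all

lemmas sd_model_simps = carrier_sd_model one_sd_model mult_sd_model

text \<open>
  \<open>(2n - 1)\<^sup>2 = 1 + 4n (n - 1)\<close>, which makes conjugation by \<open>b\<close> compatible with \<open>b\<^sup>2 = e\<close>; it gives
  associativity of the model.
\<close>

lemma twist_involution:
  fixes n k :: nat
  assumes "n \<ge> 1"
  shows "(2 * n - 1) * ((2 * n - 1) * k) mod (4 * n) = k mod (4 * n)"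
proof -
  obtain m where n: "n = Suc m" using assms by (cases n) auto
  then have c: "2 * n - 1 = 2 * m + 1" by simp
  have "(2 * n - 1) * ((2 * n - 1) * k) = k + 4 * n * (m * k)"
    unfolding c n by (simp add: algebra_simps)
  then show ?thesis by simp
qed

lemma group_sd_model:
  assumes "n \<ge> 1"
  shows "group (sd_model n)"
proof (rule groupI)
  let ?M = "sd_model n"
  let ?c = "2 * n - 1"
  show "\<one>\<^bsub>?M\<^esub> \<in> carrier ?M" using assms by (simp add: sd_model_simps)
  show "x \<otimes>\<^bsub>?M\<^esub> y \<in> carrier ?M" if "x \<in> carrier ?M" "y \<in> carrier ?M" for x y
    using that assms by (cases x; cases y) (simp add: sd_model_simps)
  define c where "c = ?c"
  have c: "c * (c * k) mod (4 * n) = k mod (4 * n)" for k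
    unfolding c_def by (rule twist_involution[OF assms])
  have mult: "(i, s) \<otimes>\<^bsub>?M\<^esub> (j, t) = ((i + (if s then c * j else j)) mod (4 * n), s \<noteq> t)"
    for i s j t
    by (simp add: mult_sd_model c_def)
  show "x \<otimes>\<^bsub>?M\<^esub> y \<otimes>\<^bsub>?M\<^esub> z = x \<otimes>\<^bsub>?M\<^esub> (y \<otimes>\<^bsub>?M\<^esub> z)" for x y z
  proof -
    obtain i s j t k r where xyz: "x = (i, s)" "y = (j, t)" "z = (k, r)"
      by (cases x; cases y; cases z) auto
    have "(i + c * (j + c * k)) mod (4 * n) = ((i + c * j) + c * (c * k)) mod (4 * n)"
      by (simp add: distrib_left add.assoc)
    also have "\<dots> = ((i + c * j) + c * (c * k) mod (4 * n)) mod (4 * n)"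
      by (simp only: mod_add_right_eq)
    also have "\<dots> = ((i + c * j) + k) mod (4 * n)"
      by (simp only: c mod_add_right_eq)
    finally have "(i + c * (j + c * k)) mod (4 * n) = (i + c * j + k) mod (4 * n)" .
    moreover have "(i + c * ((j + a) mod (4 * n))) mod (4 * n) = (i + c * (j + a)) mod (4 * n)" for a
      by (metis mod_add_right_eq mod_mult_right_eq)
    ultimately show ?thesis
      by (cases s; cases t)
        (simp_all add: xyz mult mod_add_left_eq mod_add_right_eq
          distrib_left add.assoc)
  qed
  show "\<one>\<^bsub>?M\<^esub> \<otimes>\<^bsub>?M\<^esub> x = x" if "x \<in> carrier ?M" for x
    using that by (cases x) (simp add: sd_model_simps)
  show "\<exists>y\<in>carrier ?M. y \<otimes>\<^bsub>?M\<^esub> x = \<one>\<^bsub>?M\<^esub>" if "x \<in> carrier ?M" for x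
  proof -
    obtain i s where x: "x = (i, s)" by (cases x)
    define a where "a = (if s then ?c * i else i) mod (4 * n)"
    define j where "j = (4 * n - a) mod (4 * n)"
    have "a < 4 * n" using assms by (simp add: a_def)
    then have "(j + a) mod (4 * n) = 0"
      unfolding j_def by (simp only: mod_add_left_eq le_add_diff_inverse2 less_imp_le mod_self)
    then have "(j + (if s then ?c * i else i)) mod (4 * n) = 0"
      unfolding a_def by (simp only: mod_add_right_eq)
    moreover have "j < 4 * n" using assms by (simp add: j_def)
    ultimately have "(j, s) \<in> carrier ?M" "(j, s) \<otimes>\<^bsub>?M\<^esub> x = \<one>\<^bsub>?M\<^esub>"
      by (simp_all only: x sd_model_simps) simp_all
    then show ?thesis by blast
  qed
qed

definition sd_rel :: "nat \<Rightarrow> (sd_gen word \<times> sd_gen word) set" where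
  "sd_rel n = {(word_pow word_a (4 * n), []),
      (word_pow word_b 2, []),
      (word_b @ word_a, word_pow word_a (2 * n - 1) @ word_b)}"

lemma SD_presented: "SD n = presented_group (sd_rel n)"
  by (simp add: SD_def sd_rel_def)

fun sd_gen_model :: "sd_gen \<Rightarrow> nat \<times> bool" where
  "sd_gen_model Gen_a = (1, False)"
| "sd_gen_model Gen_b = (0, True)"

lemma sd_gen_model_closed: "n \<ge> 1 \<Longrightarrow> sd_gen_model x \<in> carrier (sd_model n)"
  by (cases x) (auto simp: carrier_sd_model)

lemma nat_pow_a_sd_model:
  assumes "n \<ge> 1"
  shows "(Suc 0, False) [^]\<^bsub>sd_model n\<^esub> (m::nat) = (m mod (4 * n), False)"
proof -
  interpret group "sd_model n" using assms by (rule group_sd_model)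
  show ?thesis
  proof (induction m)
    case (Suc m)
    have "(m mod (4 * n) + Suc 0) mod (4 * n) = Suc m mod (4 * n)"
      using mod_add_left_eq[of m "4 * n" 1] by (simp only: One_nat_def add_Suc_right add_0_right)
    then show ?case by (simp only: nat_pow_Suc Suc mult_sd_model if_False) simp
  qed (simp add: one_sd_model)
qed

lemma sd_model_relations:
  assumes "n \<ge> 1" "(u, v) \<in> sd_rel n"
  shows "word_eval (sd_model n) sd_gen_model u = word_eval (sd_model n) sd_gen_model v"
proof -
  interpret group "sd_model n" using assms(1) by (rule group_sd_model)
  have range: "range sd_gen_model \<subseteq> carrier (sd_model n)"
    using sd_gen_model_closed[OF assms(1)] by auto
  have gens: "(1, False) \<in> carrier (sd_model n)" "(0, True) \<in> carrier (sd_model n)"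
    using assms(1) by (auto simp: carrier_sd_model)
  have a: "word_eval (sd_model n) sd_gen_model (word_pow word_a m) = (m mod (4 * n), False)" for m
    using gens by (simp add: word_eval_pow[OF range] nat_pow_a_sd_model[OF assms(1)])
  consider "u = word_pow word_a (4 * n)" "v = []"
    | "u = word_pow word_b 2" "v = []"
    | "u = word_b @ word_a" "v = word_pow word_a (2 * n - 1) @ word_b"
    using assms(2) unfolding sd_rel_def by blast
  then show ?thesis
  proof cases
    case 1
    then show ?thesis by (simp add: a one_sd_model)
  next
    case 2
    then show ?thesis
      using gens by (simp add: word_eval_pow[OF range] numeral_2_eq_2 sd_model_simps)
  next
    case 3
    then show ?thesis
      using gens by (simp add: word_eval_append[OF range] a sd_model_simps)
  qed
qed

definition sd_coord :: "nat \<Rightarrow> sd_gen word set \<Rightarrow> nat \<times> bool" where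
  "sd_coord n = presented_lift (sd_model n) sd_gen_model"

lemma (in group) conj_pow:
  assumes "x \<in> carrier G" "y \<in> carrier G" "y \<otimes> x = x [^] (c::nat) \<otimes> y"
  shows "y \<otimes> x [^] (j::nat) = x [^] (c * j) \<otimes> y"
proof (induction j)
  case (Suc j)
  have "y \<otimes> x [^] Suc j = x [^] (c * j) \<otimes> (y \<otimes> x)"
    using assms(1,2) Suc by (simp add: m_assoc[symmetric])
  also have "\<dots> = x [^] (c * j) \<otimes> x [^] c \<otimes> y"
    using assms by (simp add: m_assoc)
  also have "x [^] (c * j) \<otimes> x [^] c = x [^] (c * Suc j)"
    using assms(1) by (simp add: nat_pow_mult add.commute)
  finally show ?case .
qed (use assms in simp)

text \<open>
  The relations suffice to make \<open>(i, s) \<mapsto> A\<^sup>i B\<^sup>s\<close> a homomorphism from the model to the presented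
  group. It is inverse to the induced homomorphism, because both composites fix the generators.
\<close>

lemma sd_coord_iso:
  assumes "n \<ge> 1"
  shows "sd_coord n \<in> iso (SD n) (sd_model n)"
proof -
  let ?M = "sd_model n" and ?G = "SD n"
  interpret M: group ?M using assms by (rule group_sd_model)
  interpret G: group ?G by (simp add: SD_presented group_presented_group)
  have range: "range sd_gen_model \<subseteq> carrier ?M"
    using sd_gen_model_closed[OF assms(1)] by auto
  note lift = M.is_group range sd_model_relations[OF assms]
  have hom: "sd_coord n \<in> hom ?G ?M"
    unfolding sd_coord_def SD_presented by (rule presented_lift_hom[OF lift])
  interpret h: group_hom ?G ?M "sd_coord n"
    by unfold_locales (rule hom)
  have coord: "sd_coord n (word_class (sd_rel n) w) = word_eval ?M sd_gen_model w" for w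
    unfolding sd_coord_def by (rule presented_lift_word_class[OF lift])
  define g where "g x = word_class (sd_rel n) [(x, True)]" for x
  define A B where "A = g Gen_a" and "B = g Gen_b"
  have g: "range g \<subseteq> carrier ?G"
    by (auto simp: g_def SD_presented carrier_presented_group)
  have evalG: "word_eval ?G g w = word_class (sd_rel n) w" for w
    using word_eval_presented_group[of "sd_rel n" w] by (simp add: SD_presented g_def[abs_def])
  have AB: "A \<in> carrier ?G" "B \<in> carrier ?G" using g by (auto simp: A_def B_def)
  have gen: "word_eval ?G g word_a = A" "word_eval ?G g word_b = B"
    using AB by (simp_all add: A_def B_def)
  have rels: "word_eval ?G g u = word_eval ?G g v" if "(u, v) \<in> sd_rel n" for u v
    using that by (simp add: evalG word_class_eq_iff word_cong.rel)
  have A4: "A [^]\<^bsub>?G\<^esub> (4 * n) = \<one>\<^bsub>?G\<^esub>"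
    using rels[of "word_pow word_a (4 * n)" "[]"] G.word_eval_pow[OF g, of word_a] gen
    by (simp add: sd_rel_def)
  have B2: "B \<otimes>\<^bsub>?G\<^esub> B = \<one>\<^bsub>?G\<^esub>"
    using rels[of "word_pow word_b 2" "[]"] G.word_eval_pow[OF g, of word_b] gen AB
    by (simp add: sd_rel_def numeral_2_eq_2)
  have BA: "B \<otimes>\<^bsub>?G\<^esub> A = A [^]\<^bsub>?G\<^esub> (2 * n - 1) \<otimes>\<^bsub>?G\<^esub> B"
    using rels[of "word_b @ word_a" "word_pow word_a (2 * n - 1) @ word_b"]
      G.word_eval_pow[OF g, of word_a] gen
    by (simp add: sd_rel_def G.word_eval_append[OF g] del: append.simps)
  have Amod: "A [^]\<^bsub>?G\<^esub> (i mod (4 * n)) = A [^]\<^bsub>?G\<^esub> i" for i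
  proof -
    have "A [^]\<^bsub>?G\<^esub> i = A [^]\<^bsub>?G\<^esub> (4 * n * (i div (4 * n)) + i mod (4 * n))" by simp
    also have "\<dots> = (A [^]\<^bsub>?G\<^esub> (4 * n)) [^]\<^bsub>?G\<^esub> (i div (4 * n)) \<otimes>\<^bsub>?G\<^esub> A [^]\<^bsub>?G\<^esub> (i mod (4 * n))"
      using AB by (simp only: G.nat_pow_mult[symmetric] G.nat_pow_pow)
    finally show ?thesis using AB by (simp add: A4)
  qed
  \<comment> \<open>The candidate for the inverse of the induced homomorphism.\<close>
  define \<psi> where "\<psi> = (\<lambda>(i::nat, s). A [^]\<^bsub>?G\<^esub> i \<otimes>\<^bsub>?G\<^esub> (if s then B else \<one>\<^bsub>?G\<^esub>))"
  have \<psi>hom: "\<psi> \<in> hom ?M ?G"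
  proof (rule homI)
    fix x y :: "nat \<times> bool"
    show "\<psi> x \<in> carrier ?G" using AB by (simp add: \<psi>_def split_beta)
    obtain i s j t where xy: "x = (i, s)" "y = (j, t)" by (cases x; cases y)
    define T where "T = (if t then B else \<one>\<^bsub>?G\<^esub>)"
    have T: "T \<in> carrier ?G" using AB by (simp add: T_def)
    show "\<psi> (x \<otimes>\<^bsub>?M\<^esub> y) = \<psi> x \<otimes>\<^bsub>?G\<^esub> \<psi> y"
    proof (cases s)
      case False
      then show ?thesis using AB
        by (simp add: xy \<psi>_def mult_sd_model Amod G.nat_pow_mult[symmetric] G.m_assoc)
    next
      case True
      have "\<psi> x \<otimes>\<^bsub>?G\<^esub> \<psi> y = A [^]\<^bsub>?G\<^esub> i \<otimes>\<^bsub>?G\<^esub> (B \<otimes>\<^bsub>?G\<^esub> A [^]\<^bsub>?G\<^esub> j) \<otimes>\<^bsub>?G\<^esub> T"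
        using AB T True by (simp add: xy \<psi>_def T_def[symmetric] G.m_assoc)
      also have "\<dots> = A [^]\<^bsub>?G\<^esub> (i + (2 * n - 1) * j) \<otimes>\<^bsub>?G\<^esub> (B \<otimes>\<^bsub>?G\<^esub> T)"
        using AB T by (simp add: G.conj_pow[OF AB BA] G.nat_pow_mult[symmetric] G.m_assoc)
      also have "B \<otimes>\<^bsub>?G\<^esub> T = (if t then \<one>\<^bsub>?G\<^esub> else B)"
        using AB by (simp add: T_def B2)
      finally show ?thesis using True
        by (simp add: xy \<psi>_def mult_sd_model Amod)
    qed
  qed
  interpret \<psi>: group_hom ?M ?G \<psi>
    by unfold_locales (rule \<psi>hom)
  have "\<psi> (sd_coord n X) = X" if "X \<in> carrier ?G" for X
  proof -
    obtain w where w: "X = word_class (sd_rel n) w"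
      using \<open>X \<in> carrier ?G\<close> by (auto simp: SD_presented carrier_presented_group)
    have "\<psi> \<circ> sd_gen_model = g"
    proof
      fix x show "(\<psi> \<circ> sd_gen_model) x = g x"
        using AB by (cases x) (simp_all add: \<psi>_def A_def B_def)
    qed
    then show ?thesis
      using \<psi>.hom_word_eval[OF range, of w] by (simp add: w coord evalG)
  qed
  moreover have "sd_coord n (\<psi> x) = x" if x: "x \<in> carrier ?M" for x
  proof -
    obtain i s where xis: "x = (i, s)" "i < 4 * n" using x by (auto simp: carrier_sd_model)
    have gens: "(1, False) \<in> carrier ?M" "(0, True) \<in> carrier ?M"
      using assms by (auto simp: carrier_sd_model)
    have "sd_coord n A = (1, False)" "sd_coord n B = (0, True)"
      using gens by (simp_all add: A_def B_def g_def coord)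
    then show ?thesis using xis AB
      by (simp add: \<psi>_def h.hom_nat_pow nat_pow_a_sd_model[OF assms] one_sd_model mult_sd_model)
  qed
  ultimately have "bij_betw (sd_coord n) (carrier ?G) (carrier ?M)"
    by (intro bij_betw_byWitness[where f' = \<psi>]) auto
  with hom show ?thesis by (simp add: iso_def)
qed

section \<open>Cyclic subgroups and twin classes\<close>

text \<open>
  \<open>Quarter k\<close> is the pair of mutually inverse elements \<open>a\<^sup>k b\<close> and \<open>a\<^bsup>k+2n\<^esup> b\<close> of order four;
  \<open>Central\<close> is \<open>a\<^bsup>2n\<^esup>\<close>, and \<open>Reflection\<close> collects the involutions \<open>a\<^sup>i b\<close>.
\<close>

datatype twin_class = Identity | Central | Rotation | Reflection | Quarter nat

fun twin_class_of :: "nat \<Rightarrow> nat \<times> bool \<Rightarrow> twin_class" where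
  "twin_class_of n (i, s) =
    (if s then if even i then Reflection else Quarter (i mod (2 * n))
     else if i = 0 then Identity else if i = 2 * n then Central else Rotation)"

text \<open>
  The case \<open>c = d\<close> says that a class other than \<open>Reflection\<close> is a clique; two distinct
  involutions \<open>a\<^sup>i b\<close> never lie in a common cyclic subgroup.
\<close>

definition adjacent_classes :: "twin_class \<Rightarrow> twin_class \<Rightarrow> bool" where
  "adjacent_classes c d \<longleftrightarrow> c = Identity \<or> d = Identity \<or>
     (c \<noteq> Reflection \<and> d \<noteq> Reflection \<and> (c = d \<or> c = Central \<or> d = Central))"

lemma finite_carrier_sd_model: "finite (carrier (sd_model n))"
  by (simp add: carrier_sd_model)

text \<open>
  The elements that map \<open>H\<close> into itself by right multiplication form a subgroup: since \<open>H\<close> is finite,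
  such a multiplication permutes \<open>H\<close>, so the inverse maps \<open>H\<close> into itself too. This
  subgroup contains \<open>z\<close>, and it lies in \<open>H\<close> because \<open>\<one> \<in> H\<close>.
\<close>

lemma (in group) generate_subset_right_closed:
  assumes H: "finite H" "H \<subseteq> carrier G" "\<one> \<in> H"
    and z: "z \<in> carrier G" "\<And>x. x \<in> H \<Longrightarrow> x \<otimes> z \<in> H"
  shows "generate G {z} \<subseteq> H"
proof -
  have Hc: "h \<in> carrier G" if "h \<in> H" for h using H that by blast
  define T where "T = {x \<in> carrier G. \<forall>h\<in>H. h \<otimes> x \<in> H}"
  have "subgroup T G"
  proof (rule subgroupI)
    show "inv x \<in> T" if x: "x \<in> T" for x
    proof -
      have xc: "x \<in> carrier G" using x by (simp add: T_def)
      then have "inj_on (\<lambda>h. h \<otimes> x) H"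
        using Hc by (simp add: inj_on_def)
      moreover have "(\<lambda>h. h \<otimes> x) ` H \<subseteq> H" using x by (auto simp: T_def)
      ultimately have img: "(\<lambda>h. h \<otimes> x) ` H = H" using H by (intro endo_inj_surj)
      have "h \<otimes> inv x \<in> H" if "h \<in> H" for h
      proof -
        obtain g where "g \<in> H" "h = g \<otimes> x" using img \<open>h \<in> H\<close> by (auto simp: image_iff)
        then show ?thesis using Hc xc by (simp add: m_assoc)
      qed
      then show ?thesis using xc by (simp add: T_def)
    qed
    show "x \<otimes> y \<in> T" if "x \<in> T" "y \<in> T" for x y
      using that Hc by (simp add: T_def m_assoc[symmetric])
    have "\<one> \<in> T" using Hc by (simp add: T_def)
    then show "T \<noteq> {}" by blast
  qed (auto simp: T_def)
  moreover have "z \<in> T" using z by (simp add: T_def)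
  ultimately have "generate G {z} \<subseteq> T" by (intro generate_subgroup_incl) auto
  also have "T \<subseteq> H"
  proof
    fix x assume "x \<in> T"
    then have "x \<in> carrier G" "\<one> \<otimes> x \<in> H" using H by (auto simp: T_def)
    then show "x \<in> H" by simp
  qed
  finally show ?thesis .
qed

lemma even_mod_4n: "even (i mod (4 * n)) \<longleftrightarrow> even (i::nat)"
  by (simp add: dvd_mod_iff)

text \<open>
  The exponent in \<open>(a\<^sup>i b)\<^sup>2 = a\<^bsup>2ni\<^esup>\<close>.
\<close>

lemma twist_square:
  fixes n i :: nat
  assumes "n \<ge> 1"
  shows "(i + (2 * n - 1) * i) mod (4 * n) = (if even i then 0 else 2 * n)"
proof -
  have "i + (2 * n - 1) * i = 2 * n * i"
    using assms by (cases n) (simp_all add: algebra_simps)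
  moreover have "2 * n * i mod (4 * n) = (if even i then 0 else 2 * n)"
  proof (cases "even i")
    case True
    then obtain m where "i = 2 * m" by blast
    then have "2 * n * i = 4 * n * m" by simp
    then show ?thesis using True by (simp only: mod_mult_self1_is_0 if_True)
  next
    case False
    then obtain m where "i = 2 * m + 1" using oddE by blast
    then have "2 * n * i = 4 * n * m + 2 * n" by (simp add: algebra_simps)
    then show ?thesis using False assms by simp
  qed
  ultimately show ?thesis by simp
qed

lemma generate_quarter_subset:
  assumes n: "n \<ge> 1" and i: "i < 4 * n" "odd i"
  shows "generate (sd_model n) {(i, True)} \<subseteq>
    {(0, False), (2 * n, False), (i, True), ((i + 2 * n) mod (4 * n), True)}"
proof -
  interpret group "sd_model n" using n by (rule group_sd_model)
  define d where "d = (2 * n - 1) * i"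
  have "((i + 2 * n) mod (4 * n) + d) mod (4 * n) = (i + 2 * n + d) mod (4 * n)"
    by (rule mod_add_left_eq)
  also have "i + 2 * n + d = i + d + 2 * n" by simp
  also have "(i + d + 2 * n) mod (4 * n) = ((i + d) mod (4 * n) + 2 * n) mod (4 * n)"
    by (rule mod_add_left_eq[symmetric])
  finally have "((i + 2 * n) mod (4 * n) + (2 * n - 1) * i) mod (4 * n) =
      ((i + (2 * n - 1) * i) mod (4 * n) + 2 * n) mod (4 * n)"
    unfolding d_def .
  then have "((i + 2 * n) mod (4 * n) + (2 * n - 1) * i) mod (4 * n) = 0"
    unfolding twist_square[OF n] using i by simp
  then show ?thesis
    using i n by (intro generate_subset_right_closed)
      (auto simp: sd_model_simps twist_square[OF n, simplified] add.commute)
qed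

lemma generate_reflection_subset:
  assumes n: "n \<ge> 1" and i: "i < 4 * n" "even i"
  shows "generate (sd_model n) {(i, True)} \<subseteq> {(0, False), (i, True)}"
proof -
  interpret group "sd_model n" using n by (rule group_sd_model)
  show ?thesis
    using i n by (intro generate_subset_right_closed)
      (auto simp: sd_model_simps twist_square[OF n, simplified])
qed

lemma generate_rotation_subset:
  assumes n: "n \<ge> 1" and i: "i < 4 * n"
  shows "generate (sd_model n) {(i, False)} \<subseteq> {..<4 * n} \<times> {False}"
proof -
  interpret group "sd_model n" using n by (rule group_sd_model)
  show ?thesis
    using i n by (intro generate_subset_right_closed)
      (auto simp: sd_model_simps)
qed

lemma rotations_in_generate:
  assumes n: "n \<ge> 1" and i: "i < 4 * n"
  shows "(i, False) \<in> generate (sd_model n) {(1, False)}"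
proof -
  interpret group "sd_model n" using n by (rule group_sd_model)
  have "(Suc 0, False) \<in> carrier (sd_model n)" using n by (simp add: carrier_sd_model)
  moreover have "(i, False) = (Suc 0, False) [^]\<^bsub>sd_model n\<^esub> (int i)"
    using i by (simp add: nat_pow_a_sd_model[OF n] int_pow_int)
  ultimately show ?thesis by (auto simp: generate_pow)
qed

text \<open>
  For \<open>z = a\<^sup>i b\<close> with \<open>i\<close> odd, the two elements are \<open>z\<^sup>2\<close> and \<open>z\<^sup>3\<close>.
\<close>

lemma quarter_in_generate:
  assumes n: "n \<ge> 1" and i: "i < 4 * n" "odd i"
  shows "(2 * n, False) \<in> generate (sd_model n) {(i, True)}"
    and "((2 * n + i) mod (4 * n), True) \<in> generate (sd_model n) {(i, True)}"
proof -
  let ?z = "(i, True)" and ?M = "sd_model n"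
  have z: "?z \<in> generate ?M {?z}" by (simp add: generate.incl)
  have "?z \<otimes>\<^bsub>?M\<^esub> ?z = (2 * n, False)"
    using i twist_square[OF n, of i] by (simp add: mult_sd_model)
  then show *: "(2 * n, False) \<in> generate ?M {?z}"
    using generate.eng[OF z z] by simp
  show "((2 * n + i) mod (4 * n), True) \<in> generate ?M {?z}"
    using generate.eng[OF * z] by (simp add: mult_sd_model)
qed

lemma quarter_partner:
  fixes i j n :: nat
  assumes "i < 4 * n" "j < 4 * n" "i mod (2 * n) = j mod (2 * n)" "i \<noteq> j"
  shows "j = (2 * n + i) mod (4 * n)"
proof -
  have "i mod (2 * n) = (if i < 2 * n then i else i - 2 * n)" if "i < 4 * n" for i
    using that by (simp add: mod_if)
  with assms show ?thesis by (auto split: if_splits simp: mod_if)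
qed

text \<open>
  The generated subgroup consists of powers of \<open>a\<close>, or of the identity and one involution
  \<open>a\<^sup>i b\<close>, or it lies in the union of \<open>Identity\<close>, \<open>Central\<close> and one \<open>Quarter\<close>.
\<close>

lemma common_cyclic_imp_adjacent_classes:
  assumes n: "n \<ge> 1" and z: "z \<in> carrier (sd_model n)" and "x \<noteq> y"
    and "x \<in> generate (sd_model n) {z}" "y \<in> generate (sd_model n) {z}"
  shows "adjacent_classes (twin_class_of n x) (twin_class_of n y)"
proof -
  obtain i s where z: "z = (i, s)" "i < 4 * n" using z by (auto simp: carrier_sd_model)
  consider "\<not> s" | "s" "even i" | "s" "odd i" by blast
  then show ?thesis
  proof cases
    case 1
    then have "x \<in> {..<4 * n} \<times> {False}" "y \<in> {..<4 * n} \<times> {False}"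
      using assms z generate_rotation_subset[OF n z(2)] by auto
    then show ?thesis by (auto simp: adjacent_classes_def split: if_splits)
  next
    case 2
    then have "x \<in> {(0, False), (i, True)}" "y \<in> {(0, False), (i, True)}"
      using assms(4,5) z generate_reflection_subset[OF n z(2)] by auto
    then have "x = (0, False) \<or> y = (0, False)" using \<open>x \<noteq> y\<close> by auto
    then show ?thesis by (auto simp: adjacent_classes_def)
  next
    case 3
    have "twin_class_of n w \<in> {Identity, Central, Quarter (i mod (2 * n))}"
      if "w \<in> generate (sd_model n) {z}" for w
    proof -
      have "(i + 2 * n) mod (4 * n) mod (2 * n) = i mod (2 * n)"
        by (simp add: mod_mod_cancel)
      then show ?thesis
        using that 3 z generate_quarter_subset[OF n z(2)] by (auto simp: even_mod_4n)
    qed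
    then have "twin_class_of n x \<in> {Identity, Central, Quarter (i mod (2 * n))}"
      "twin_class_of n y \<in> {Identity, Central, Quarter (i mod (2 * n))}"
      using assms(4,5) by simp_all
    then show ?thesis unfolding adjacent_classes_def by (elim insertE) simp_all
  qed
qed

text \<open>
  If one vertex is the identity, the other one generates a suitable subgroup; for two powers of \<open>a\<close>
  the generator is \<open>a\<close>; in the remaining cases a vertex of order four occurs, and its powers include \<open>a\<^bsup>2n\<^esup>\<close>
  and its twin.
\<close>

lemma adjacent_classes_imp_common_cyclic:
  assumes n: "n \<ge> 1" and xy: "x \<in> carrier (sd_model n)" "y \<in> carrier (sd_model n)" "x \<noteq> y"
    and "adjacent_classes (twin_class_of n x) (twin_class_of n y)"
  shows "\<exists>z\<in>carrier (sd_model n). x \<in> generate (sd_model n) {z} \<and> y \<in> generate (sd_model n) {z}"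
proof -
  let ?M = "sd_model n"
  have in_self: "w \<in> generate ?M {w}" for w by (simp add: generate.incl)
  have one: "(0, False) \<in> generate ?M {w}" for w
    using generate.one[of ?M "{w}"] by (simp add: one_sd_model)
  have Id: "w = (0, False)" if "twin_class_of n w = Identity" for w
    using that by (cases w) (auto split: if_splits)
  have Ce: "w = (2 * n, False)" if "twin_class_of n w = Central" for w
    using that by (cases w) (auto split: if_splits)
  have Qu: "\<exists>i. w = (i, True) \<and> odd i \<and> k = i mod (2 * n)" if "twin_class_of n w = Quarter k" for w k
    using that by (cases w) (auto split: if_splits)
  have Ro: "\<exists>i<4 * n. w = (i, False)"
    if "w \<in> carrier ?M" "twin_class_of n w \<in> {Central, Rotation}" for w
    using that by (cases w) (auto simp: carrier_sd_model split: if_splits)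
  have CQ: "(2 * n, False) \<in> generate ?M {w}" if "w \<in> carrier ?M" "twin_class_of n w = Quarter k" for w k
    using Qu[OF that(2)] that(1) quarter_in_generate(1)[OF n] by (auto simp: carrier_sd_model)
  consider "twin_class_of n x = Identity" | "twin_class_of n y = Identity"
    | "twin_class_of n x \<in> {Central, Rotation}" "twin_class_of n y \<in> {Central, Rotation}"
    | k where "twin_class_of n x = Central" "twin_class_of n y = Quarter k"
    | k where "twin_class_of n y = Central" "twin_class_of n x = Quarter k"
    | k where "twin_class_of n x = Quarter k" "twin_class_of n y = Quarter k"
    using assms(5) by (cases "twin_class_of n x"; cases "twin_class_of n y") (auto simp: adjacent_classes_def)
  then show ?thesis
  proof cases
    case 1
    then show ?thesis using Id one in_self xy by blast
  next
    case 2
    then show ?thesis using Id one in_self xy by blast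
  next
    case 3
    then obtain i j where "x = (i, False)" "i < 4 * n" "y = (j, False)" "j < 4 * n"
      using Ro xy by blast
    moreover have "(1, False) \<in> carrier ?M" using n by (simp add: carrier_sd_model)
    ultimately show ?thesis using rotations_in_generate[OF n] by blast
  next
    case 4
    then show ?thesis using Ce CQ in_self xy by blast
  next
    case 5
    then show ?thesis using Ce CQ in_self xy by blast
  next
    case 6
    then obtain i j where ij: "x = (i, True)" "odd i" "y = (j, True)" "i mod (2 * n) = j mod (2 * n)"
      using Qu by metis
    then have "j = (2 * n + i) mod (4 * n)"
      using xy by (intro quarter_partner) (auto simp: carrier_sd_model)
    then have "y \<in> generate ?M {x}"
      using ij xy quarter_in_generate(2)[OF n, of i] by (simp add: carrier_sd_model)
    then show ?thesis using in_self xy by blast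
  qed
qed

section \<open>Sizes and separation of the twin classes\<close>

lemma image_twin_class_of:
  assumes "n \<ge> 1"
  shows "twin_class_of n ` carrier (sd_model n) =
    {Identity, Central, Rotation, Reflection} \<union> Quarter ` {k. k < 2 * n \<and> odd k}" (is "?A = ?B")
proof
  have "twin_class_of n (i, s) \<in> ?B" for i s
  proof (cases "s \<and> odd i")
    case True
    then have "i mod (2 * n) < 2 * n" "odd (i mod (2 * n))"
      using assms by (simp_all add: dvd_mod_iff)
    with True show ?thesis by simp
  qed auto
  then have "twin_class_of n x \<in> ?B" for x by (metis surj_pair)
  then show "?A \<subseteq> ?B" by blast
  show "?B \<subseteq> ?A"
  proof
    fix c assume "c \<in> ?B"
    then consider "c = Identity" | "c = Central" | "c = Rotation" | "c = Reflection"
      | k where "c = Quarter k" "k < 2 * n" "odd k" by blast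
    then show "c \<in> ?A"
    proof cases
      case 1
      then show ?thesis using assms by (intro image_eqI[of _ _ "(0, False)"]) (auto simp: carrier_sd_model)
    next
      case 2
      then show ?thesis using assms by (intro image_eqI[of _ _ "(2 * n, False)"]) (auto simp: carrier_sd_model)
    next
      case 3
      then show ?thesis using assms by (intro image_eqI[of _ _ "(1, False)"]) (auto simp: carrier_sd_model)
    next
      case 4
      then show ?thesis using assms by (intro image_eqI[of _ _ "(0, True)"]) (auto simp: carrier_sd_model)
    next
      case 5
      then show ?thesis using assms by (intro image_eqI[of _ _ "(k, True)"]) (auto simp: carrier_sd_model)
    qed
  qed
qed

definition twin_fibre :: "nat \<Rightarrow> twin_class \<Rightarrow> (nat \<times> bool) set" where
  "twin_fibre n c = {x \<in> carrier (sd_model n). twin_class_of n x = c}"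

lemma twin_fibre_eq:
  assumes "n \<ge> 1"
  shows "twin_fibre n Identity = {(0, False)}"
    and "twin_fibre n Central = {(2 * n, False)}"
    and "twin_fibre n Rotation = ({..<4 * n} - {0, 2 * n}) \<times> {False}"
    and "twin_fibre n Reflection = {i. i < 4 * n \<and> even i} \<times> {True}"
    and "k < 2 * n \<Longrightarrow> odd k \<Longrightarrow> twin_fibre n (Quarter k) = {(k, True), (k + 2 * n, True)}"
proof -
  show "twin_fibre n Identity = {(0, False)}" "twin_fibre n Central = {(2 * n, False)}"
    "twin_fibre n Rotation = ({..<4 * n} - {0, 2 * n}) \<times> {False}"
    "twin_fibre n Reflection = {i. i < 4 * n \<and> even i} \<times> {True}"
    using assms by (auto simp: twin_fibre_def carrier_sd_model split: if_splits)
  assume k: "k < 2 * n" "odd k"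
  have "i mod (2 * n) = (if i < 2 * n then i else i - 2 * n)" if "i < 4 * n" for i
    using that by (simp add: mod_if)
  then show "twin_fibre n (Quarter k) = {(k, True), (k + 2 * n, True)}"
    using k assms by (auto simp: twin_fibre_def carrier_sd_model split: if_splits)
qed

lemma card_even_below: "card {i. i < 2 * m \<and> even i} = m" and card_odd_below: "card {i. i < 2 * m \<and> odd i} = m"
proof -
  have "{i. i < 2 * m \<and> even i} = (\<lambda>j. 2 * j) ` {..<m}" by (auto elim!: evenE)
  then show "card {i. i < 2 * m \<and> even i} = m" by (simp add: card_image inj_on_def)
  have "{i. i < 2 * m \<and> odd i} = (\<lambda>j. 2 * j + 1) ` {..<m}" by (auto elim!: oddE)
  then show "card {i. i < 2 * m \<and> odd i} = m" by (simp add: card_image inj_on_def)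
qed

lemma card_twin_fibre:
  assumes "n \<ge> 1"
  shows "card (twin_fibre n Identity) = 1"
    and "card (twin_fibre n Central) = 1"
    and "card (twin_fibre n Rotation) = 4 * n - 2"
    and "card (twin_fibre n Reflection) = 2 * n"
    and "k < 2 * n \<Longrightarrow> odd k \<Longrightarrow> card (twin_fibre n (Quarter k)) = 2"
proof -
  have "card ({..<4 * n} - {0, 2 * n}) = 4 * n - 2"
    using assms by (subst card_Diff_subset) auto
  moreover have "card {i. i < 4 * n \<and> even i} = 2 * n"
    using card_even_below[of "2 * n"] by simp
  ultimately show "card (twin_fibre n Identity) = 1" "card (twin_fibre n Central) = 1"
    "card (twin_fibre n Rotation) = 4 * n - 2" "card (twin_fibre n Reflection) = 2 * n"
    "k < 2 * n \<Longrightarrow> odd k \<Longrightarrow> card (twin_fibre n (Quarter k)) = 2"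
    using assms by (simp_all add: twin_fibre_eq card_cartesian_product)
qed

lemma two_twins:
  assumes "n \<ge> 1" "c \<in> twin_class_of n ` carrier (sd_model n)" "c \<noteq> Identity" "c \<noteq> Central"
  shows "\<exists>x\<in>carrier (sd_model n). \<exists>y\<in>carrier (sd_model n).
    x \<noteq> y \<and> twin_class_of n x = c \<and> twin_class_of n y = c"
proof -
  have "card (twin_fibre n c) \<ge> 2"
    using assms card_twin_fibre[OF assms(1)] by (auto simp: image_twin_class_of)
  moreover have "finite (twin_fibre n c)"
    using finite_carrier_sd_model by (simp add: twin_fibre_def)
  ultimately have "\<exists>x\<in>twin_fibre n c. \<exists>y\<in>twin_fibre n c. x \<noteq> y"
    using card_le_Suc0_iff_eq[of "twin_fibre n c"] by auto
  then show ?thesis unfolding twin_fibre_def by blast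
qed

text \<open>
  A witnessing class is \<open>Reflection\<close> if one of \<open>c\<close> and \<open>d\<close> is \<open>Identity\<close>, since \<open>Identity\<close> is the only
  class adjacent to it. \<open>Rotation\<close> sees, besides \<open>Identity\<close>, exactly \<open>Central\<close> and itself; any
  \<open>Quarter\<close> tells these two apart. What remains involves a \<open>Quarter k\<close>, which
  is adjacent to itself but neither to \<open>Reflection\<close> nor to another \<open>Quarter\<close>.
\<close>

lemma twin_classes_separated:
  assumes n: "n \<ge> 1" and c: "c \<in> twin_class_of n ` carrier (sd_model n)"
    and d: "d \<in> twin_class_of n ` carrier (sd_model n)" and "c \<noteq> d"
  shows "\<exists>x\<in>carrier (sd_model n). \<exists>y\<in>carrier (sd_model n). x \<noteq> y \<and>
    twin_class_of n x = twin_class_of n y \<and> adjacent_classes (twin_class_of n x) c \<noteq> adjacent_classes (twin_class_of n x) d"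
proof -
  let ?L = "twin_class_of n ` carrier (sd_model n)"
  have L: "Rotation \<in> ?L" "Reflection \<in> ?L" "Quarter 1 \<in> ?L"
    using n by (auto simp: image_twin_class_of)
  have "\<exists>l\<in>?L. l \<noteq> Identity \<and> l \<noteq> Central \<and> adjacent_classes l c \<noteq> adjacent_classes l d"
  proof -
    consider "c = Identity \<or> d = Identity"
      | "c \<in> {Central, Rotation}" "d \<in> {Central, Rotation}"
      | "c \<in> {Central, Rotation} \<longleftrightarrow> d \<notin> {Central, Rotation}" "c \<noteq> Identity" "d \<noteq> Identity"
      | k where "c = Quarter k \<or> d = Quarter k"
          "c \<notin> {Identity, Central, Rotation}" "d \<notin> {Identity, Central, Rotation}"
      using \<open>c \<noteq> d\<close> by (cases c; cases d) auto
    then show ?thesis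
    proof cases
      case 1
      then show ?thesis using \<open>c \<noteq> d\<close> L by (intro bexI[of _ Reflection]) (auto simp: adjacent_classes_def)
    next
      case 2
      then show ?thesis using \<open>c \<noteq> d\<close> L by (intro bexI[of _ "Quarter 1"]) (auto simp: adjacent_classes_def)
    next
      case 3
      then show ?thesis using L by (intro bexI[of _ Rotation]) (auto simp: adjacent_classes_def)
    next
      case (4 k)
      then have "Quarter k \<in> ?L" using c d by metis
      then show ?thesis using \<open>c \<noteq> d\<close> 4
        by (intro bexI[of _ "Quarter k"]) (auto simp: adjacent_classes_def)
    qed
  qed
  then show ?thesis using two_twins[OF n] by metis
qed

section \<open>Resolving sets of the enhanced power graph\<close>

abbreviation sd_graph :: "nat \<Rightarrow> sd_gen word set pair_pre_digraph" where
  "sd_graph n \<equiv> enhanced_power_graph (SD n)"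

text \<open>
  Isomorphisms commute with \<open>generate\<close>, so adjacency may be decided in the model.
\<close>

lemma parcs_sd_graph_iff:
  assumes n: "n \<ge> 1" and uv: "u \<in> carrier (SD n)" "v \<in> carrier (SD n)"
  shows "(u, v) \<in> parcs (sd_graph n) \<longleftrightarrow>
    u \<noteq> v \<and> adjacent_classes (twin_class_of n (sd_coord n u)) (twin_class_of n (sd_coord n v))"
proof -
  let ?h = "sd_coord n" and ?G = "SD n" and ?M = "sd_model n"
  have iso: "?h \<in> iso ?G ?M" by (rule sd_coord_iso[OF n])
  interpret h: group_hom ?G ?M ?h
    using iso group_sd_model[OF n] group_presented_group
    by (simp add: group_hom_def group_hom_axioms_def iso_def SD_presented)
  have bij: "bij_betw ?h (carrier ?G) (carrier ?M)" using iso by (simp add: iso_def)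
  then have inj: "inj_on ?h (carrier ?G)" and img: "?h ` carrier ?G = carrier ?M"
    by (simp_all add: bij_betw_def)
  have gen: "w \<in> generate ?G {z} \<longleftrightarrow> ?h w \<in> generate ?M {?h z}"
    if "w \<in> carrier ?G" "z \<in> carrier ?G" for w z
  proof -
    have "generate ?M {?h z} = ?h ` generate ?G {z}"
      using h.generate_img[of "{z}"] that by simp
    moreover have "generate ?G {z} \<subseteq> carrier ?G"
      using h.G.generate_incl that by blast
    ultimately show ?thesis using that inj by (auto dest: inj_onD)
  qed
  have "(\<exists>z\<in>carrier ?G. u \<in> generate ?G {z} \<and> v \<in> generate ?G {z}) \<longleftrightarrow>
      (\<exists>z\<in>carrier ?M. ?h u \<in> generate ?M {z} \<and> ?h v \<in> generate ?M {z})"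
    using gen uv by (simp add: img[symmetric] cong: bex_cong)
  also have "\<dots> \<longleftrightarrow> adjacent_classes (twin_class_of n (?h u)) (twin_class_of n (?h v))" if "u \<noteq> v"
  proof -
    have "?h u \<noteq> ?h v" "?h u \<in> carrier ?M" "?h v \<in> carrier ?M"
      using uv inj that by (auto dest: inj_onD)
    then show ?thesis
      using common_cyclic_imp_adjacent_classes[OF n] adjacent_classes_imp_common_cyclic[OF n] by metis
  qed
  finally show ?thesis using uv by (auto simp: enhanced_power_graph_def)
qed

lemma bij_sd_coord: "n \<ge> 1 \<Longrightarrow> bij_betw (sd_coord n) (carrier (SD n)) (carrier (sd_model n))"
  using sd_coord_iso by (simp add: iso_def)

lemma finite_carrier_SD: "n \<ge> 1 \<Longrightarrow> finite (carrier (SD n))"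
  using bij_betw_finite[OF bij_sd_coord] finite_carrier_sd_model by blast

lemma card_carrier_SD: "n \<ge> 1 \<Longrightarrow> card (carrier (SD n)) = 8 * n"
  using bij_betw_same_card[OF bij_sd_coord] by (simp add: carrier_sd_model card_cartesian_product)

lemma resolving_set_sd_graph_iff:
  assumes n: "n \<ge> 1"
  shows "resolving_set (sd_graph n) U \<longleftrightarrow>
    U \<subseteq> carrier (SD n) \<and> inj_on (twin_class_of n \<circ> sd_coord n) (carrier (SD n) - U)"
proof -
  let ?G = "SD n" and ?t = "twin_class_of n \<circ> sd_coord n"
  have V: "pverts (sd_graph n) = carrier ?G" by (simp add: enhanced_power_graph_def)
  have img: "sd_coord n ` carrier ?G = carrier (sd_model n)"
    using bij_sd_coord[OF n] by (simp add: bij_betw_def)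
  have "(0, False) \<in> carrier (sd_model n)" using n by (simp add: carrier_sd_model)
  then obtain e where e: "e \<in> carrier ?G" "sd_coord n e = (0, False)"
    using img by (metis imageE)
  show ?thesis unfolding V[symmetric]
  proof (rule resolving_set_iff_inj_on[where R = adjacent_classes and e = e])
    show "pair_graph (sd_graph n)"
      by (rule pair_graph_enhanced_power_graph[OF finite_carrier_SD[OF n]])
    show "e \<in> pverts (sd_graph n)" using e V by simp
    show "adjacent_classes (?t e) (?t v)" for v using e by (simp add: adjacent_classes_def)
    show "(u, v) \<in> parcs (sd_graph n) \<longleftrightarrow> u \<noteq> v \<and> adjacent_classes (?t u) (?t v)"
      if "u \<in> pverts (sd_graph n)" "v \<in> pverts (sd_graph n)" for u v
      using parcs_sd_graph_iff[OF n] that V by simp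
    fix u v assume uv: "u \<in> pverts (sd_graph n)" "v \<in> pverts (sd_graph n)" "?t u \<noteq> ?t v"
    then have "?t u \<in> twin_class_of n ` carrier (sd_model n)" "?t v \<in> twin_class_of n ` carrier (sd_model n)"
      using img V by auto
    from twin_classes_separated[OF n this uv(3)]
    obtain x y where xy: "x \<in> sd_coord n ` carrier ?G" "y \<in> sd_coord n ` carrier ?G" "x \<noteq> y"
      "twin_class_of n x = twin_class_of n y" "adjacent_classes (twin_class_of n x) (?t u) \<noteq> adjacent_classes (twin_class_of n x) (?t v)"
      unfolding img by blast
    from xy(1,2) obtain x' y' where "x' \<in> carrier ?G" "x = sd_coord n x'"
      "y' \<in> carrier ?G" "y = sd_coord n y'" by blast
    with xy show "\<exists>x\<in>pverts (sd_graph n). \<exists>y\<in>pverts (sd_graph n). x \<noteq> y \<and> ?t x = ?t y \<and>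
        adjacent_classes (?t x) (?t u) \<noteq> adjacent_classes (?t x) (?t v)"
      unfolding V by (intro bexI[of _ x'] bexI[of _ y']) (auto simp del: twin_class_of.simps)
  qed
qed

section \<open>The resolving polynomial\<close>

text \<open>
  The generating function, by size, of the complements of resolving sets: one factor for each twin
  class.
\<close>

definition sd_complement_poly :: "nat \<Rightarrow> int poly" where
  "sd_complement_poly n = [:1, 1:] ^ 2 * [:1, 4 * int n - 2:] * [:1, 2 * int n:] * [:1, 2:] ^ n"

text \<open>
  The coordinates of \<open>sd_coord_iso\<close> carry the class sizes over from the model.
\<close>

lemma card_twin_fibre_SD:
  assumes n: "n \<ge> 1"
  shows "card {x \<in> carrier (SD n). (twin_class_of n \<circ> sd_coord n) x = c} = card (twin_fibre n c)"
proof -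
  have "carrier (sd_model n) = sd_coord n ` carrier (SD n)"
    using bij_sd_coord[OF n] by (simp add: bij_betw_def)
  then have "sd_coord n ` {x \<in> carrier (SD n). (twin_class_of n \<circ> sd_coord n) x = c} = twin_fibre n c"
    unfolding twin_fibre_def by auto
  moreover have "inj_on (sd_coord n) {x \<in> carrier (SD n). (twin_class_of n \<circ> sd_coord n) x = c}"
    by (rule inj_on_subset[OF bij_betw_imp_inj_on[OF bij_sd_coord[OF n]]]) blast
  ultimately show ?thesis using card_image by fastforce
qed

lemma card_sd_complements:
  assumes n: "n \<ge> 1"
  shows "int (card {M. M \<subseteq> carrier (SD n) \<and> inj_on (twin_class_of n \<circ> sd_coord n) M \<and> card M = m}) =
    coeff (sd_complement_poly n) m"
proof -
  let ?t = "twin_class_of n \<circ> sd_coord n"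
  let ?Q = "Quarter ` {k. k < 2 * n \<and> odd k}"
  let ?f = "\<lambda>c. [:1, int (card (twin_fibre n c)):]"
  have "?t ` carrier (SD n) = {Identity, Central, Rotation, Reflection} \<union> ?Q"
    by (simp only: image_comp[symmetric] bij_betw_imp_surj_on[OF bij_sd_coord[OF n]] image_twin_class_of[OF n])
  then have "(\<Prod>c\<in>?t ` carrier (SD n). ?f c) =
      (\<Prod>c\<in>{Identity, Central, Rotation, Reflection}. ?f c) * (\<Prod>c\<in>?Q. ?f c)"
    by (simp only:) (rule prod.union_disjoint, auto)
  also have "(\<Prod>c\<in>?Q. ?f c) = (\<Prod>k\<in>{k. k < 2 * n \<and> odd k}. ?f (Quarter k))"
    by (subst prod.reindex) (auto simp: inj_on_def)
  also have "\<dots> = (\<Prod>k\<in>{k. k < 2 * n \<and> odd k}. [:1, 2:])"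
    using card_twin_fibre(5)[OF n] by (intro prod.cong) auto
  also have "\<dots> = [:1, 2:] ^ n"
    by (simp add: card_odd_below)
  also have "(\<Prod>c\<in>{Identity, Central, Rotation, Reflection}. ?f c) =
      [:1, 1:] * ([:1, 1:] * ([:1, 4 * int n - 2:] * [:1, 2 * int n:]))"
    using n by (simp add: card_twin_fibre[OF n] of_nat_diff)
  finally have "(\<Prod>c\<in>?t ` carrier (SD n). ?f c) = sd_complement_poly n"
    by (simp only: sd_complement_poly_def power2_eq_square mult.assoc)
  then show ?thesis
    using card_partial_transversals[OF finite_carrier_SD[OF n], of ?t m]
    unfolding card_twin_fibre_SD[OF n] by simp
qed

lemma card_resolving_sets:
  assumes n: "n \<ge> 1" and "i \<le> 8 * n"
  shows "int (card {U. resolving_set (sd_graph n) U \<and> card U = i}) =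
    coeff (sd_complement_poly n) (8 * n - i)"
proof -
  let ?V = "carrier (SD n)"
  let ?A = "{U. resolving_set (sd_graph n) U \<and> card U = i}"
  let ?B = "{M. M \<subseteq> ?V \<and> inj_on (twin_class_of n \<circ> sd_coord n) M \<and> card M = 8 * n - i}"
  have card: "card (?V - W) = 8 * n - card W" "card W \<le> 8 * n" if "W \<subseteq> ?V" for W
    using that finite_carrier_SD[OF n] card_carrier_SD[OF n] card_mono[of ?V W]
    by (auto simp: card_Diff_subset finite_subset)
  have "bij_betw (\<lambda>U. ?V - U) ?A ?B"
    using assms(2) card
    by (intro bij_betw_byWitness[where f' = "\<lambda>U. ?V - U"])
      (auto simp: resolving_set_sd_graph_iff[OF n] double_diff simp del: twin_class_of.simps)
  then have "card ?A = card ?B" by (rule bij_betw_same_card)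
  then show ?thesis by (simp only: card_sd_complements[OF n])
qed

text \<open>
  The summation in the resolving polynomial starts at the metric dimension, but no resolving set is
  smaller, so its zero coefficients below that degree also count resolving sets.
\<close>

lemma coeff_resolving_poly:
  assumes "n \<ge> 1"
  shows "coeff (resolving_poly (sd_graph n)) i =
    (if i \<le> 8 * n then coeff (sd_complement_poly n) (8 * n - i) else 0)"
proof -
  let ?r = "\<lambda>i. int (card {U. resolving_set (sd_graph n) U \<and> card U = i})"
  have V: "card (pverts (sd_graph n)) = 8 * n"
    using card_carrier_SD[OF assms] by (simp add: enhanced_power_graph_def)
  have "coeff (resolving_poly (sd_graph n)) i =
      (if i \<in> {metric_dim (sd_graph n)..8 * n} then ?r i else 0)"
    by (simp add: resolving_poly_def V coeff_sum coeff_monom)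
  moreover have "?r i = 0" if "i < metric_dim (sd_graph n)"
  proof -
    have "{U. resolving_set (sd_graph n) U \<and> card U = i} = {}"
      using that not_less_Least unfolding metric_dim_def by blast
    then show ?thesis by (metis card.empty of_nat_0)
  qed
  ultimately show ?thesis using card_resolving_sets[OF assms, of i] by (auto simp: not_le)
qed

lemma binom_pow2_eq_coeff: "binom_pow2 n (int n - int m) = coeff ([:1, 2:] ^ n) m"
proof (cases "m \<le> n")
  case True
  then have "nat (int n - int m) = n - m" by simp
  then show ?thesis using True
    by (simp add: binom_pow2_def binom_def coeff_linear_poly_power binomial_symmetric[symmetric])
next
  case False
  have "degree ([:1, 2 :: int:] ^ n) \<le> n"
    using degree_power_le[of "[:1, 2 :: int:]" n] by simp
  then show ?thesis using False by (simp add: binom_pow2_def binom_def coeff_eq_0)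
qed

lemma binom_pow2_eq_0: "m < 0 \<or> m > int n \<Longrightarrow> binom_pow2 n m = 0"
  by (auto simp: binom_pow2_def binom_def)

text \<open>
  Convolution of \<open>k\<^sub>0, \<dots>, k\<^sub>4\<close> with the coefficients of \<open>(1 + 2x)\<^sup>n\<close>. The range of summation can be
  taken as \<open>{0..4}\<close> for every \<open>i \<le> 8n\<close>, because the binomial coefficient vanishes when \<open>j > 8n - i\<close>.
\<close>

lemma coeff_sd_complement_poly:
  assumes "i \<le> 8 * n"
  shows "coeff (sd_complement_poly n) (8 * n - i) =
    (\<Sum>j = 0..4. binom_pow2 n (int i - 7 * int n + int j) * k_coeff n j)"
proof -
  let ?K = "[:1, 1:] ^ 2 * [:1, 4 * int n - 2:] * [:1, 2 * int n:]"
  have "?K = [:1, 6 * int n, 8 * (int n)\<^sup>2 + 8 * int n - 3, 16 * (int n)\<^sup>2 - 2 * int n - 2,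
      8 * (int n)\<^sup>2 - 4 * int n:]"
    by (simp add: power2_eq_square algebra_simps)
  then have K: "coeff ?K j = k_coeff n j" for j
    by (simp add: k_coeff_def coeff_pCons numeral_eq_Suc split: nat.split)
  have "coeff (sd_complement_poly n) (8 * n - i) =
      (\<Sum>j\<le>8 * n - i. k_coeff n j * coeff ([:1, 2:] ^ n) (8 * n - i - j))"
    unfolding sd_complement_poly_def coeff_mult[of ?K] K ..
  also have "\<dots> = (\<Sum>j = 0..4. binom_pow2 n (int i - 7 * int n + int j) * k_coeff n j)"
  proof (rule sum.mono_neutral_cong)
    show "binom_pow2 n (int i - 7 * int n + int j) * k_coeff n j = 0"
      if "j \<in> {0..4} - {..8 * n - i}" for j
    proof -
      have "binom_pow2 n (int i - 7 * int n + int j) = 0"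
        using that by (intro binom_pow2_eq_0 disjI2) auto
      then show ?thesis by simp
    qed
    show "k_coeff n j * coeff ([:1, 2:] ^ n) (8 * n - i - j) = 0" if "j \<in> {..8 * n - i} - {0..4}" for j
      using that by (simp add: k_coeff_def)
    show "k_coeff n j * coeff ([:1, 2:] ^ n) (8 * n - i - j) =
        binom_pow2 n (int i - 7 * int n + int j) * k_coeff n j" if "j \<in> {..8 * n - i} \<inter> {0..4}" for j
    proof -
      have "int i - 7 * int n + int j = int n - int (8 * n - i - j)"
        using that assms by auto
      then show ?thesis by (simp only: binom_pow2_eq_coeff mult.commute)
    qed
  qed auto
  finally show ?thesis .
qed

theorem theorem3p13:
  fixes n :: nat
  assumes "n \<ge> 2"
  shows "\<exists>r :: nat \<Rightarrow> int.
    (\<forall>i. 7 * n - 4 \<le> i \<and> i \<le> 7 * n - 1 \<longrightarrow>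
      r i = (\<Sum>j = 0..i - (7 * n - 4). binom_pow2 n (int j) * k_coeff n (7 * n + j - i))) \<and>
    (\<forall>i. 7 * n \<le> i \<and> i \<le> 8 * n - 4 \<longrightarrow>
      r i = (\<Sum>j = 0..4. binom_pow2 n (int i - 7 * int n + int j) * k_coeff n j)) \<and>
    (\<forall>i. 8 * n - 3 \<le> i \<and> i \<le> 8 * n - 2 \<longrightarrow>
      r i = (\<Sum>j = 0..8 * n - i. binom_pow2 n (int n + int j - (8 * int n - int i)) * k_coeff n j)) \<and>
    resolving_poly (enhanced_power_graph (SD n)) =
      monom 1 (8 * n) + monom (8 * int n) (8 * n - 1) + (\<Sum>i = 7 * n - 4..8 * n - 2. monom (r i) i)"
proof (intro exI conjI allI impI)
  let ?P = "sd_complement_poly n"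
  let ?r = "\<lambda>i. coeff ?P (8 * n - i)"
  let ?g = "\<lambda>i j. binom_pow2 n (int i - 7 * int n + int j) * k_coeff n j"
  have n: "n \<ge> 1" using assms by simp
  note formula = coeff_sd_complement_poly[of _ n]
  have g0: "?g i j = 0" if "int i - 7 * int n + int j < 0 \<or> int i - 7 * int n + int j > int n" for i j
    using binom_pow2_eq_0[OF that] by simp
  show "?r i = (\<Sum>j = 0..i - (7 * n - 4). binom_pow2 n (int j) * k_coeff n (7 * n + j - i))"
    if i: "7 * n - 4 \<le> i \<and> i \<le> 7 * n - 1" for i
  proof -
    have "?r i = (\<Sum>j = 0..4. ?g i j)" using i by (intro formula) linarith
    also have "\<dots> = (\<Sum>j = 7 * n - i..4. ?g i j)"
      using i by (intro sum.mono_neutral_right ballI g0 disjI1) auto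
    also have "\<dots> = (\<Sum>j = 0..i - (7 * n - 4). binom_pow2 n (int j) * k_coeff n (7 * n + j - i))"
      using i assms by (intro sum.reindex_bij_witness
        [of _ "\<lambda>j. 7 * n + j - i" "\<lambda>j. j - (7 * n - i)"]) (auto simp: of_nat_diff algebra_simps)
    finally show ?thesis .
  qed
  show "?r i = (\<Sum>j = 0..4. ?g i j)" if "7 * n \<le> i \<and> i \<le> 8 * n - 4" for i
    using that by (intro formula) linarith
  show "?r i = (\<Sum>j = 0..8 * n - i. binom_pow2 n (int n + int j - (8 * int n - int i)) * k_coeff n j)"
    if i: "8 * n - 3 \<le> i \<and> i \<le> 8 * n - 2" for i
  proof -
    have "?r i = (\<Sum>j = 0..4. ?g i j)" using i by (intro formula) linarith
    also have "\<dots> = (\<Sum>j = 0..8 * n - i. ?g i j)"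
      using i assms by (intro sum.mono_neutral_right ballI g0 disjI2) auto
    also have "\<dots> = (\<Sum>j = 0..8 * n - i. binom_pow2 n (int n + int j - (8 * int n - int i)) * k_coeff n j)"
      by (simp add: algebra_simps)
    finally show ?thesis .
  qed
  show "resolving_poly (sd_graph n) = monom 1 (8 * n) + monom (8 * int n) (8 * n - 1) +
      (\<Sum>i = 7 * n - 4..8 * n - 2. monom (?r i) i)"
  proof (rule poly_eqI)
    fix i
    \<comment> \<open>Below \<open>7n - 4\<close> all binomial coefficients in the convolution have a negative lower index.\<close>
    have low: "?r i = 0" if "i < 7 * n - 4"
    proof -
      have "?r i = (\<Sum>j = 0..4. ?g i j)" using that by (intro formula) linarith
      also have "\<dots> = 0" using that by (intro sum.neutral ballI g0 disjI1) auto
      finally show ?thesis .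
    qed
    have c0: "coeff ?P 0 = 1"
      by (simp add: sd_complement_poly_def coeff_mult_0 coeff_0_power power2_eq_square)
    have "coeff ([:1, 2:] ^ n) 1 = 2 * int n"
      using n by (simp add: coeff_linear_poly_power)
    then have c1: "coeff ?P 1 = 8 * int n"
      by (simp add: sd_complement_poly_def coeff_mult power2_eq_square coeff_0_power)
    have "coeff (monom 1 (8 * n) + monom (8 * int n) (8 * n - 1) +
        (\<Sum>i = 7 * n - 4..8 * n - 2. monom (?r i) i)) i =
      (if i = 8 * n then 1 else 0) + (if i = 8 * n - 1 then 8 * int n else 0) +
        (if i \<in> {7 * n - 4..8 * n - 2} then ?r i else 0)"
      by (simp add: coeff_sum coeff_monom)
    also have "\<dots> = (if i \<le> 8 * n then ?r i else 0)"
    proof -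
      consider "i < 7 * n - 4" | "7 * n - 4 \<le> i" "i \<le> 8 * n - 2" | "i = 8 * n - 1" | "i = 8 * n" | "i > 8 * n"
        by linarith
      then show ?thesis
        using n low c0 c1 by cases auto
    qed
    finally show "coeff (resolving_poly (sd_graph n)) i = coeff (monom 1 (8 * n) +
        monom (8 * int n) (8 * n - 1) + (\<Sum>i = 7 * n - 4..8 * n - 2. monom (?r i) i)) i"
      using coeff_resolving_poly[OF n] by simp
  qed
qed

end
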